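(* Let $\tau>0$ and let $\mathbf{A},\mathbf{B}\in\mathbb{R}^{2\times 2}$ be of the form $$\mathbf{A}=\begin{bmatrix}0&1\\ a_{21}&a_{22}\end{bmatrix},\qquad \mathbf{B}=\begin{bmatrix}0&0\\ b_{21}&b_{22}\end{bmatrix}.$$ Let $\lambda_1\neq\lambda_2$ be two real, simple characteristic roots of the system $\dot{\mathbf{x}}(t)=\mathbf{A}\mathbf{x}(t)+\mathbf{B}\mathbf{x}(t-\tau)$. Then for at least one $k\in\{0,-1\}$ there exists a real matrix $\mathbf{M}_k\in\mathbb{R}^{2\times2}$, of the form $\mathbf{M}_k=\tau\mathbf{B}\mathbf{Q}_k$ for some matrix $\mathbf{Q}_k$, which solves $$\mathbf{W}_k(\mathbf{M}_k)\exp\left(\mathbf{W}_k(\mathbf{M}_k)+\mathbf{A}\tau\right)-\tau\mathbf{B}=\mathbf{0},$$ and such that $\lambda_1$ and $\lambda_2$ are the eigenvalues of the matrix $$\mathbf{S}_k=\frac1\tau\mathbf{W}_k(\mathbf{M}_k)+\mathbf{A}.$$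
   Context: Characteristic roots of $\dot{\mathbf{x}}(t)=\mathbf{A}\mathbf{x}(t)+\mathbf{B}\mathbf{x}(t-\tau)$ are the complex zeros $s$ of $\det(s\mathbf{I}-\mathbf{A}-\mathbf{B}e^{-s\tau})$; a root is simple if it is a simple zero of this function. Scalar Lambert W function: for $z\in\mathbb{C}$, the multivalued function $W(z)$ is defined by $W(z)e^{W(z)}=z$; $W_k(z)$, $k\in\mathbb{Z}$, denotes its $k$-th branch with the standard branch cuts of Corless et al. (1996). For real arguments, the only real-valued branches are: $W_0$, real on $[-1/e,\infty)$ with range $[-1,\infty)$; and $W_{-1}$, real on $[-1/e,0)$ with range $(-\infty,-1]$. Moreover $W_0(0)=0$, $W_0'(0)=1$, and $W_k(0)=\infty$ for $k\neq0$. Matrix Lambert W function (with the "hybrid branch" convention): let $\mathbf{H}\in\mathbb{C}^{n\times n}$ have Jordan decomposition $\mathbf{H}=\mathbf{Z}\,\mathrm{diag}(\mathbf{J}_1(\lambda_1),\dots,\mathbf{J}_p(\lambda_p))\,\mathbf{Z}^{-1}$ (here the $\lambda_i$ denote eigenvalues of $\mathbf{H}$). Then $\mathbf{W}_k(\mathbf{H})=\mathbf{Z}\,\mathrm{diag}(\mathbf{W}_k(\mathbf{J}_1(\lambda_1)),\dots,\mathbf{W}_k(\mathbf{J}_p(\lambda_p)))\,\mathbf{Z}^{-1}$, where for a Jordan block $\mathbf{J}_i(\lambda_i)$ of size $m$ with $\lambda_i\ne0$, $\mathbf{W}_k(\mathbf{J}_i(\lambda_i))$ is the $m\times m$ upper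 triangular Toeplitz matrix whose entry on the $j$-th superdiagonal is $\frac{1}{j!}W_k^{(j)}(\lambda_i)$, $j=0,\dots,m-1$; and for blocks with $\lambda_i=0$ the same formula is used with the branch $k$ replaced by $0$ (whatever the value of $k$). When $k=0$ it is assumed that $-e^{-1}$ is not an eigenvalue of $\mathbf{H}$ belonging to a Jordan block of size larger than 1 (since $W_0'(-e^{-1})$ is undefined). $\exp$ denotes the matrix exponential. *)

theory Defs
  imports
    "HOL-Complex_Analysis.Complex_Analysis"
    "Jordan_Normal_Form.Spectral_Radius"
begin

section \<open>Characteristic roots of a linear system with a single delay\<close>

abbreviation cmat :: "real mat \<Rightarrow> complex mat" where
  "cmat \<equiv> map_mat complex_of_real"

definition delay_char_fun :: "real mat \<Rightarrow> real mat \<Rightarrow> real \<Rightarrow> complex \<Rightarrow> complex" where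
  "delay_char_fun A B \<tau> s =
     Determinant.det (s \<cdot>\<^sub>m 1\<^sub>m (dim_row A) - cmat A - exp (- s * of_real \<tau>) \<cdot>\<^sub>m cmat B)"

definition characteristic_root :: "real mat \<Rightarrow> real mat \<Rightarrow> real \<Rightarrow> complex \<Rightarrow> bool" where
  "characteristic_root A B \<tau> s \<longleftrightarrow> delay_char_fun A B \<tau> s = 0"

definition simple_characteristic_root :: "real mat \<Rightarrow> real mat \<Rightarrow> real \<Rightarrow> complex \<Rightarrow> bool" where
  "simple_characteristic_root A B \<tau> s \<longleftrightarrow>
     characteristic_root A B \<tau> s \<and> zorder (delay_char_fun A B \<tau>) s = 1"


section \<open>The matrix exponential\<close>

definition mat_exp :: "complex mat \<Rightarrow> complex mat" where
  "mat_exp A = mat (dim_row A) (dim_row A) (\<lambda>(i, j). \<Sum>m. (A ^\<^sub>m m) $$ (i, j) / fact m)"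


section \<open>The branches of the scalar Lambert W function\<close>

text \<open>
  \<open>lambert_W_range k\<close> is the range of the \<open>k\<close>-th branch in the sense of Corless et al. (1996).
  The preimage of the negative real axis under \<open>w \<mapsto> w * exp w\<close> consists of the points with
  \<open>Im w + Arg w\<close> an odd multiple of \<open>pi\<close>, that is, of the curves
  \<open>{- \<eta> * cot \<eta> + \<i> * \<eta>}\<close> and of the negative real axis.  These curves separate the ranges, and
  each range contains its upper but not its lower boundary curve, so that the branches are
  continuous from above along their cuts.  On the negative real axis only the part below \<open>-1\<close>
  is a boundary; it separates the branches \<open>-1\<close> and \<open>1\<close> and belongs to the former.  The point
  \<open>-1\<close> is the value of both branches \<open>0\<close> and \<open>-1\<close> at the branch point \<open>- exp (-1)\<close>.
\<close>

definition lambert_W_range :: "int \<Rightarrow> complex set" where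
  "lambert_W_range k =
     {w. if w = 0 then k = 0
         else if w = -1 then k \<in> {0, -1}
         else if w \<in> \<real> \<and> Re w < -1 then k = -1
         else (2 * of_int k - 1) * pi < Im w + Arg w \<and> Im w + Arg w \<le> (2 * of_int k + 1) * pi}"

text \<open>For \<open>k \<noteq> 0\<close> the value \<open>lambert_W k 0\<close> is unspecified.\<close>

definition lambert_W :: "int \<Rightarrow> complex \<Rightarrow> complex" where
  "lambert_W k z = (THE w. w \<in> lambert_W_range k \<and> w * exp w = z)"

subsection \<open>The real-valued branches\<close>

lemma xexp_strict_mono: fixes x y :: real assumes "-1 \<le> x" "x < y" shows "x * exp x < y * exp y"
proof -
  have "\<exists>z>x. z < y \<and> y * exp y - x * exp x = (y - x) * (exp z + z * exp z)"
    by (rule MVT2[OF assms(2)]) (auto intro!: derivative_eq_intros simp: algebra_simps)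
  then obtain z where z: "z > x" "z < y" "y * exp y - x * exp x = (y - x) * (exp z + z * exp z)" by blast
  have "exp z + z * exp z = (1 + z) * exp z" by (simp add: algebra_simps)
  moreover have "(y - x) * ((1 + z) * exp z) > 0" using z assms by auto
  ultimately show ?thesis using z by simp
qed

lemma xexp_strict_antimono: fixes x y :: real assumes "x < y" "y \<le> -1" shows "x * exp x > y * exp y"
proof -
  have "\<exists>z>x. z < y \<and> y * exp y - x * exp x = (y - x) * (exp z + z * exp z)"
    by (rule MVT2[OF assms(1)]) (auto intro!: derivative_eq_intros simp: algebra_simps)
  then obtain z where z: "z > x" "z < y" "y * exp y - x * exp x = (y - x) * (exp z + z * exp z)" by blast
  have e: "exp z + z * exp z = (1 + z) * exp z" by (simp add: algebra_simps)
  have "(y - x) * ((1 + z) * exp z) < 0" using z assms by (intro mult_pos_neg mult_neg_pos) auto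
  thus ?thesis using z e by simp
qed

lemma xexp_ge: fixes x :: real shows "- exp (-1) \<le> x * exp x"
  using xexp_strict_mono[of "-1" x] xexp_strict_antimono[of x "-1"] by (cases "x = -1"; cases "x < -1") auto

lemma xexp_polar: "w * exp w = of_real (norm w * exp (Re w)) * cis (Im w + Arg w)"
proof -
  have 1: "w = of_real (norm w) * cis (Arg w)"
    using Arg_eq[of w] by (cases "w = 0") (auto simp: cis_conv_exp)
  have 2: "exp w = of_real (exp (Re w)) * cis (Im w)" by (simp add: exp_eq_polar exp_of_real)
  have "w * exp w = (of_real (norm w) * cis (Arg w)) * (of_real (exp (Re w)) * cis (Im w))"
    using arg_cong2[OF 1 2, of "(*)"] .
  also have "\<dots> = of_real (norm w * exp (Re w)) * (cis (Im w) * cis (Arg w))"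
    by (simp only: of_real_mult mult_ac)
  finally show ?thesis by (simp only: cis_mult)
qed

lemma mult_cos_less_sin: fixes y :: real assumes "0 < y" "y < pi" shows "y * cos y < sin y"
proof -
  have "\<exists>z>0. z < y \<and> (sin y - y * cos y) - (sin 0 - 0 * cos 0) = (y - 0) * (z * sin z)"
    by (rule MVT2[OF assms(1)]) (auto intro!: derivative_eq_intros simp: algebra_simps)
  then obtain z where z: "z > 0" "z < y" "sin y - y * cos y = y * (z * sin z)" by auto
  have "sin z > 0" using z assms by (intro sin_gt_zero) auto
  thus ?thesis using z assms by (smt (verit) mult_pos_pos)
qed

lemma Re_Im_eq_norm_Arg: "Im w = norm w * sin (Arg w)" "Re w = norm w * cos (Arg w)"
proof -
  have "w = of_real (norm w) * cis (Arg w)"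
    using Arg_eq[of w] by (cases "w = 0") (auto simp: cis_conv_exp)
  thus "Im w = norm w * sin (Arg w)" "Re w = norm w * cos (Arg w)"
    by (metis Im_complex_of_real Re_complex_of_real cis.sel rcis_def Re_rcis Im_rcis)+
qed

lemma xexp_nonreal_less_pi: assumes "Im w \<noteq> 0" "Im w + Arg w = pi" shows "Re (w * exp w) < - exp (-1)"
proof -
  define y where "y = Im w"
  define r where "r = norm w"
  have th: "Arg w = pi - y" using assms y_def by simp
  have ys: "y = r * sin y" and re: "Re w = - (r * cos y)" using Re_Im_eq_norm_Arg[of w] th by (simp_all add: y_def[symmetric] r_def)
  have r: "r > 0" using assms by (auto simp: r_def)
  have "y \<ge> 0" using th Arg_le_pi[of w] by simp
  hence y0: "y > 0" using assms y_def by auto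
  have "y < 2*pi" using th mpi_less_Arg[of w] by simp
  moreover have "sin y > 0" using ys y0 r by (metis zero_less_mult_pos)
  ultimately have ypi: "y < pi" using sin_le_zero[of y] by fastforce
  have r1: "r > 1"
  proof -
    have "\<exists>z>0. z < y \<and> sin y - sin 0 = (y - 0) * cos z"
      by (rule MVT2[OF y0]) (auto intro!: derivative_eq_intros)
    then obtain z where z: "z > 0" "z < y" "sin y = y * cos z" by auto
    have "cos z < 1" using cos_monotone_0_pi[of 0 z] z ypi by simp
    hence "sin y < y" using z y0 by simp
    show ?thesis
    proof (rule ccontr)
      assume "\<not> r > 1"
      hence "r * sin y \<le> 1 * sin y" using \<open>sin y > 0\<close> by (intro mult_right_mono) auto
      thus False using \<open>sin y < y\<close> ys by linarith
    qed
  qed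
  have "r * cos y * sin y < 1 * sin y"
  proof -
    have "r * cos y * sin y = y * cos y" by (subst (3) ys) (simp only: mult.assoc mult.commute mult.left_commute)
    thus ?thesis using mult_cos_less_sin[OF y0 ypi] by linarith
  qed
  hence "r * cos y < 1" using \<open>sin y > 0\<close> by (simp only: mult_less_cancel_right_pos)
  hence "exp (-1) < exp (Re w)" using re by simp
  also have "\<dots> < r * exp (Re w)" using r1 by simp
  finally have "exp (-1) < r * exp (Re w)" .
  moreover have "Re (w * exp w) = - (r * exp (Re w))"
    by (subst xexp_polar) (simp only: assms(2) r_def Im_complex_of_real Re_complex_of_real times_complex.sel cis.sel mult_zero_left diff_0_right cos_pi mult_minus_right mult_1_right)
  ultimately show ?thesis by simp
qed

lemma xexp_nonreal_less_minus_pi: assumes "Im w \<noteq> 0" "Im w + Arg w = -pi" shows "Re (w * exp w) < - exp (-1)"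
proof -
  have "w \<notin> \<real>" using assms complex_is_Real_iff by blast
  hence "Arg (cnj w) = - Arg w" by (simp add: Arg_cnj)
  hence "Re (cnj w * exp (cnj w)) < - exp (-1)" using assms by (intro xexp_nonreal_less_pi) auto
  moreover have "Re (cnj w * exp (cnj w)) = Re (w * exp w)" by (simp add: Re_exp Im_exp)
  ultimately show ?thesis by simp
qed

lemma xexp_real_sin_eq_0: assumes "w * exp w = complex_of_real x" "w \<noteq> 0" shows "sin (Im w + Arg w) = 0"
proof -
  have "Im (w * exp w) = 0" unfolding assms(1) by simp
  moreover have "Im (w * exp w) = norm w * exp (Re w) * sin (Im w + Arg w)"
    by (subst xexp_polar) (simp only: Im_complex_of_real Re_complex_of_real times_complex.sel cis.sel mult_zero_left add_0_right)
  ultimately show ?thesis using assms(2) by simp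
qed

lemma Im_plus_Arg_eq_0D: assumes "Im w + Arg w = 0" shows "Im w = 0"
proof (rule ccontr)
  assume "Im w \<noteq> 0"
  thus False using assms Arg_lt_pi[of w] Arg_less_0[of w]  by linarith
qed

lemma lambert_W_0_real: assumes "-1 \<le> x" shows "lambert_W 0 (of_real (x * exp x)) = of_real x"
  unfolding lambert_W_def
proof (rule the_equality)
  show "complex_of_real x \<in> lambert_W_range 0 \<and> complex_of_real x * exp (complex_of_real x) = of_real (x * exp x)"
    using assms by (auto simp: lambert_W_range_def exp_of_real Arg_of_real)
next
  fix w assume w: "w \<in> lambert_W_range 0 \<and> w * exp w = complex_of_real (x * exp x)"
  have im: "Im w = 0"
  proof (rule ccontr)
    assume i: "Im w \<noteq> 0"
    hence w0: "w \<noteq> 0" "w \<noteq> -1" "w \<notin> \<real>" by (auto simp: complex_is_Real_iff)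
    have r: "- pi < Im w + Arg w" "Im w + Arg w \<le> pi" using w w0 by (auto simp: lambert_W_range_def)
    have "sin (Im w + Arg w) = 0" using xexp_real_sin_eq_0[of w "x * exp x"] w w0 by simp
    hence "Im w + Arg w = 0 \<or> Im w + Arg w = pi" using r sin_eq_0_pi[of "Im w + Arg w"] by force
    thus False
    proof
      assume "Im w + Arg w = 0" thus False using Im_plus_Arg_eq_0D i by blast
    next
      assume "Im w + Arg w = pi" from xexp_nonreal_less_pi[OF i this] w xexp_ge[of x] show False by simp
    qed
  qed
  define v where "v = Re w"
  have v: "w = of_real v" using im by (simp add: v_def complex_eq_iff)
  have vr: "complex_of_real v \<in> lambert_W_range 0" using w unfolding v[symmetric] by blast
  have "v \<ge> -1"
    using vr by (auto simp: lambert_W_range_def complex_eq_iff split: if_splits)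
  moreover have "v * exp v = x * exp x"
  proof -
    have "complex_of_real (v * exp v) = of_real (x * exp x)" using w unfolding v by (simp only: exp_of_real of_real_mult)
    thus ?thesis by (simp only: of_real_eq_iff)
  qed
  ultimately have "v = x" using xexp_strict_mono[of v x] xexp_strict_mono[of x v] assms by force
  thus "w = of_real x" using v by simp
qed

lemma lambert_W_minus_1_real: assumes "x \<le> -1" shows "lambert_W (-1) (of_real (x * exp x)) = of_real x"
  unfolding lambert_W_def
proof (rule the_equality)
  have "x = -1 \<or> x < -1" using assms by auto
  thus "complex_of_real x \<in> lambert_W_range (-1) \<and> complex_of_real x * exp (complex_of_real x) = of_real (x * exp x)"
    using assms by (auto simp: lambert_W_range_def exp_of_real Arg_of_real)
next
  fix w assume w: "w \<in> lambert_W_range (-1) \<and> w * exp w = complex_of_real (x * exp x)"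
  have im: "Im w = 0"
  proof (rule ccontr)
    assume i: "Im w \<noteq> 0"
    hence w0: "w \<noteq> 0" "w \<noteq> -1" "w \<notin> \<real>" by (auto simp: complex_is_Real_iff)
    have r: "- 3 * pi < Im w + Arg w" "Im w + Arg w \<le> - pi" using w w0 by (auto simp: lambert_W_range_def)
    have s: "sin (Im w + Arg w) = 0" using xexp_real_sin_eq_0[of w "x * exp x"] w w0 by simp
    have "x * exp x < 0" using assms by (intro mult_neg_pos) auto
    moreover have "x * exp x = norm w * exp (Re w) * cos (Im w + Arg w)"
    proof -
      have "Re (w * exp w) = norm w * exp (Re w) * cos (Im w + Arg w)"
        by (subst xexp_polar) (simp only: Im_complex_of_real Re_complex_of_real times_complex.sel cis.sel mult_zero_left diff_0_right)
      thus ?thesis using w by simp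
    qed
    ultimately have c: "cos (Im w + Arg w) < 0"
      by (smt (verit) exp_gt_zero mult_nonneg_nonneg norm_ge_zero)
    have "Im w + Arg w = -pi"
    proof -
      define t where "t = Im w + Arg w + 2 * pi"
      have t: "-pi < t" "t \<le> pi" "sin t = 0" "cos t < 0" using r s c by (auto simp: t_def)
      hence "t = 0 \<or> t = pi" using sin_eq_0_pi[of t] by force
      hence "t = pi" using t by auto
      thus ?thesis by (simp add: t_def)
    qed
    from xexp_nonreal_less_minus_pi[OF i this] w xexp_ge[of x] show False by simp
  qed
  define v where "v = Re w"
  have v: "w = of_real v" using im by (simp add: v_def complex_eq_iff)
  have vr: "complex_of_real v \<in> lambert_W_range (-1)" using w unfolding v[symmetric] by blast
  have "v \<le> -1"
    using vr pi_gt_zero by (auto simp: lambert_W_range_def Arg_of_real complex_eq_iff split: if_splits)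
  moreover have "v * exp v = x * exp x"
  proof -
    have "complex_of_real (v * exp v) = of_real (x * exp x)" using w unfolding v by (simp only: exp_of_real of_real_mult)
    thus ?thesis by (simp only: of_real_eq_iff)
  qed
  ultimately have "v = x" using xexp_strict_antimono[of v x] xexp_strict_antimono[of x v] assms by force
  thus "w = of_real x" using v by simp
qed


subsection \<open>Derivatives of the branches\<close>

text \<open>
  A branch is not complex differentiable at the points of its cuts, and for \<open>k = -1\<close> these
  include the interval \<open>{- exp (-1)<..<0}\<close> on which the branch is real.  There, the derivatives
  are those of the analytic local inverse of \<open>w \<mapsto> w * exp w\<close> with value \<open>lambert_W k z\<close> at \<open>z\<close>,
  i.e. of the analytic continuation of the branch across the cut; on the interval above these are
  the real derivatives.  Off the cuts the local inverse coincides with the branch near \<open>z\<close>.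
\<close>

definition lambert_W_deriv :: "int \<Rightarrow> nat \<Rightarrow> complex \<Rightarrow> complex" where
  "lambert_W_deriv k j z =
     (if j = 0 then lambert_W k z
      else (deriv ^^ j) (SOME g. g analytic_on {z} \<and> g z = lambert_W k z \<and>
                                 (\<forall>\<^sub>F u in nhds z. g u * exp (g u) = u)) z)"


section \<open>The matrix Lambert W function\<close>

definition lambert_W_jordan_block :: "int \<Rightarrow> nat \<Rightarrow> complex \<Rightarrow> complex mat" where
  "lambert_W_jordan_block k m \<mu> =
     mat m m (\<lambda>(i, j). if i \<le> j
                       then lambert_W_deriv (if \<mu> = 0 then 0 else k) (j - i) \<mu> / fact (j - i)
                       else 0)"

text \<open>
  \<open>is_mat_lambert_W k H X\<close>: some Jordan decomposition of \<open>H\<close> yields \<open>X\<close> as the value of the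
  \<open>k\<close>-th branch.  No value is assigned if the derivatives at the branch point \<open>- exp (-1)\<close> would
  be needed for one of the two branches \<open>0\<close> and \<open>-1\<close> that are singular there.
\<close>

definition is_mat_lambert_W :: "int \<Rightarrow> complex mat \<Rightarrow> complex mat \<Rightarrow> bool" where
  "is_mat_lambert_W k H X \<longleftrightarrow>
     (\<exists>blocks Z Zinv.
        0 \<notin> fst ` set blocks \<and>
        similar_mat_wit H (jordan_matrix blocks) Z Zinv \<and>
        (k \<in> {0, -1} \<longrightarrow> (\<forall>(m, \<mu>) \<in> set blocks. \<mu> = - exp (-1) \<longrightarrow> m = 1)) \<and>
        X = Z * diag_block_mat (map (\<lambda>(m, \<mu>). lambert_W_jordan_block k m \<mu>) blocks) * Zinv)"

definition mat_lambert_W_defined :: "int \<Rightarrow> complex mat \<Rightarrow> bool" where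
  "mat_lambert_W_defined k H \<longleftrightarrow> (\<exists>X. is_mat_lambert_W k H X)"

definition mat_lambert_W :: "int \<Rightarrow> complex mat \<Rightarrow> complex mat" where
  "mat_lambert_W k H = (THE X. is_mat_lambert_W k H X)"

end

theory Submission
  imports Defs
begin

text \<open>
  The rows of \<open>A\<close> and \<open>B\<close> force the solution.  Since \<open>M = \<tau> B Q\<close> has a vanishing first row, so has
  \<open>W = W\<^sub>k(M)\<close>, and \<open>S = W / \<tau> + A\<close> is a companion matrix.  It has the eigenvalues \<open>\<lambda>\<^sub>1\<close> and \<open>\<lambda>\<^sub>2\<close>
  exactly if the second row \<open>(w\<^sub>1, w\<^sub>2)\<close> of \<open>W\<close> is
  \<open>w\<^sub>1 = \<tau> (- \<lambda>\<^sub>1 \<lambda>\<^sub>2 - a\<^sub>2\<^sub>1)\<close>, \<open>w\<^sub>2 = \<tau> (\<lambda>\<^sub>1 + \<lambda>\<^sub>2 - a\<^sub>2\<^sub>2)\<close>.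

  This real matrix \<open>W\<close> satisfies \<open>W exp(W + \<tau> A) = \<tau> B\<close>.  The two sides agree on the eigenvectors
  \<open>(1, \<lambda>\<^sub>i)\<close> of \<open>S\<close>, because the second component of \<open>W exp(\<tau> S) (1, \<lambda>\<^sub>i)\<close> is
  \<open>exp(\<tau> \<lambda>\<^sub>i) (w\<^sub>1 + w\<^sub>2 \<lambda>\<^sub>i) = \<tau> exp(\<tau> \<lambda>\<^sub>i) (\<lambda>\<^sub>i\<^sup>2 - a\<^sub>2\<^sub>1 - a\<^sub>2\<^sub>2 \<lambda>\<^sub>i)\<close>, which the characteristic equation
  turns into \<open>\<tau> (b\<^sub>2\<^sub>1 + b\<^sub>2\<^sub>2 \<lambda>\<^sub>i)\<close>.  The calculation is carried out with the closed form of
  \<open>exp(\<tau> S)\<close> in \<open>mat_exp_two_point\<close>, see \<open>mult_mat_exp_companion\<close>.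

  It remains to write \<open>W\<close> as a value of a branch.  The relation \<open>W\<^sup>2 = w\<^sub>2 W\<close> suggests
  \<open>M = exp(w\<^sub>2) W\<close>, which satisfies \<open>M\<^sup>2 = w\<^sub>2 exp(w\<^sub>2) M\<close>.  Such a matrix has eigenvalues in
  \<open>{0, w\<^sub>2 exp(w\<^sub>2)}\<close> and is diagonalizable unless \<open>w\<^sub>2 = 0\<close>, in which case it squares to zero.  As
  \<open>W\<^sub>0(0) = 0\<close> and \<open>W\<^sub>0'(0) = 1\<close>, in both cases \<open>W\<^sub>k(M) = exp(- w\<^sub>2) M = W\<close>, provided that
  \<open>W\<^sub>k(w\<^sub>2 exp(w\<^sub>2)) = w\<^sub>2\<close>; this is \<open>mat_lambert_W_quadratic\<close>.  The real number \<open>w\<^sub>2\<close> lies in the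
  range of one of the two real branches: in that of \<open>W\<^sub>0\<close> if \<open>w\<^sub>2 \<ge> -1\<close> and in that of \<open>W\<^sub>-\<^sub>1\<close>
  otherwise.
\<close>

section \<open>Block diagonal matrices and Jordan blocks\<close>

lemma smult_diag_block_mat:
  fixes c :: "'a :: mult_zero"
  shows "c \<cdot>\<^sub>m diag_block_mat As = diag_block_mat (map ((\<cdot>\<^sub>m) c) As)"
proof (induction As)
  case (Cons A As)
  let ?D = "diag_block_mat As"
  have "c \<cdot>\<^sub>m four_block_mat A (0\<^sub>m (dim_row A) (dim_col ?D)) (0\<^sub>m (dim_row ?D) (dim_col A)) ?D
      = four_block_mat (c \<cdot>\<^sub>m A) (c \<cdot>\<^sub>m 0\<^sub>m (dim_row A) (dim_col ?D))
          (c \<cdot>\<^sub>m 0\<^sub>m (dim_row ?D) (dim_col A)) (c \<cdot>\<^sub>m ?D)"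
    by (rule eq_matI) auto
  moreover have "c \<cdot>\<^sub>m 0\<^sub>m r s = 0\<^sub>m r s" for r s
    by (rule eq_matI) auto
  ultimately show ?case
    by (simp add: Let_def Cons.IH[symmetric])
qed (auto intro: eq_matI)

text \<open>Equal shapes make the block boundaries coincide, so that a matrix equation between block
  diagonal matrices can be read off block by block.\<close>

lemma diag_block_mat_map_inj:
  assumes "diag_block_mat (map f xs) = diag_block_mat (map g xs)"
    and "\<And>x. x \<in> set xs \<Longrightarrow> dim_row (f x) = dim_row (g x) \<and> dim_col (f x) = dim_col (g x)"
    and "x \<in> set xs"
  shows "f x = g x"
  using assms
proof (induction xs)
  case (Cons y ys)
  let ?F = "diag_block_mat (map f ys)" and ?G = "diag_block_mat (map g ys)"
  let ?r = "dim_row (f y)" and ?c = "dim_col (f y)"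
  have dims: "dim_row (g y) = ?r" "dim_col (g y) = ?c"
    using Cons.prems(2)[of y] by auto
  have "map (dim_row \<circ> g) ys = map (dim_row \<circ> f) ys" "map (dim_col \<circ> g) ys = map (dim_col \<circ> f) ys"
    using Cons.prems(2) by auto
  then have DIMS: "dim_row ?G = dim_row ?F" "dim_col ?G = dim_col ?F"
    by (simp_all only: dim_diag_block_mat map_map)
  have eq: "four_block_mat (f y) (0\<^sub>m ?r (dim_col ?F)) (0\<^sub>m (dim_row ?F) ?c) ?F
          = four_block_mat (g y) (0\<^sub>m ?r (dim_col ?F)) (0\<^sub>m (dim_row ?F) ?c) ?G" (is "?L = ?R")
    using Cons.prems(1) by (simp add: Let_def dims DIMS)
  have "f y = g y"
  proof (rule eq_matI)
    fix i j assume "i < dim_row (g y)" "j < dim_col (g y)"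
    moreover have "?L $$ (i, j) = ?R $$ (i, j)"
      by (simp only: eq)
    ultimately show "f y $$ (i, j) = g y $$ (i, j)"
      by (simp add: dims)
  qed (auto simp: dims)
  moreover have "?F = ?G"
  proof (rule eq_matI)
    fix i j assume "i < dim_row ?G" "j < dim_col ?G"
    moreover have "?L $$ (i + ?r, j + ?c) = ?R $$ (i + ?r, j + ?c)"
      by (simp only: eq)
    ultimately show "?F $$ (i, j) = ?G $$ (i, j)"
      by (simp add: dims DIMS)
  qed (auto simp: DIMS)
  ultimately show ?case
    using Cons.IH Cons.prems by auto
qed simp

text \<open>The minimal polynomial of a Jordan block of size \<open>m\<close> is \<open>(X - a)\<^sup>m\<close>, and it divides
  \<open>X * (X - \<mu>)\<close> in these cases only.\<close>

lemma quadratic_jordan_block: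
  fixes a \<mu> :: complex
  assumes "jordan_block m a ^\<^sub>m 2 = \<mu> \<cdot>\<^sub>m jordan_block m a" and "m \<noteq> 0"
  shows "m = 1 \<and> (a = 0 \<or> a = \<mu>) \<or> m = 2 \<and> a = 0 \<and> \<mu> = 0"
proof -
  have entry: "(if i \<le> j then of_nat (2 choose (j - i)) * a ^ (2 + i - j) else 0)
      = \<mu> * (if i = j then a else if Suc i = j then 1 else 0)" if "i < m" "j < m" for i j
    using arg_cong[OF assms(1), of "\<lambda>J. J $$ (i, j)"] that by (simp add: jordan_block_pow)
  have diag: "a = 0 \<or> a = \<mu>"
    using entry[of 0 0] \<open>m \<noteq> 0\<close> by (simp add: power2_eq_square)
  have sup1: "2 * a = \<mu>" if "m \<ge> 2"
    using entry[of 0 1] that by simp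
  have "m \<le> 2"
    using entry[of 0 2] by (cases "m \<le> 2") auto
  then show ?thesis
    using diag sup1 \<open>m \<noteq> 0\<close> by (cases "m = 1") auto
qed

section \<open>The matrix Lambert W function of a matrix with a quadratic relation\<close>

text \<open>The inverse function theorem shows that the choice in the definition of the derivatives ranges
  over a nonempty set of local inverses; differentiating \<open>h u * exp (h u) = u\<close> at \<open>0\<close> gives the same
  derivative for each of them.\<close>

lemma lambert_W_deriv_0_1: "lambert_W_deriv 0 1 0 = 1"
proof -
  let ?f = "\<lambda>w::complex. w * exp w"
  let ?P = "\<lambda>g. g analytic_on {0} \<and> g 0 = lambert_W 0 0 \<and> (\<forall>\<^sub>F u in nhds 0. g u * exp (g u) = u)"
  have W0: "lambert_W 0 0 = 0"
    using lambert_W_0_real[of 0] by simp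
  have der: "(?f has_field_derivative 1) (at 0)"
    by (auto intro!: derivative_eq_intros)
  have hol: "?f holomorphic_on S" for S
    by (intro holomorphic_intros)
  obtain r where r: "r > 0" "open (?f ` ball 0 r)" "inj_on ?f (ball 0 r)"
    using has_complex_derivative_locally_invertible[OF hol, of 0 UNIV] DERIV_imp_deriv[OF der] by auto
  obtain g where g: "g holomorphic_on (?f ` ball 0 r)" "\<And>z. z \<in> ball 0 r \<Longrightarrow> g (?f z) = z"
    using holomorphic_has_inverse[OF hol open_ball r(3)] by metis
  have 0: "0 \<in> ?f ` ball 0 r"
    using r(1) by (auto intro!: image_eqI[of _ _ 0])
  have "?P g"
  proof (intro conjI)
    show "g analytic_on {0}"
      using 0 g(1) r(2) analytic_at by blast
    show "g 0 = lambert_W 0 0"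
      using g(2)[of 0] r(1) W0 by simp
    show "\<forall>\<^sub>F u in nhds 0. g u * exp (g u) = u"
      using eventually_nhds_in_open[OF r(2) 0] by eventually_elim (use g(2) in auto)
  qed
  then have P: "?P (SOME g. ?P g)"
    by (rule someI[of ?P])
  define h where "h = (SOME g. ?P g)"
  have h: "?P h"
    using P by (simp add: h_def)
  have dh: "(h has_field_derivative deriv h 0) (at 0)"
    using h analytic_on_imp_differentiable_at DERIV_deriv_iff_field_differentiable by blast
  have "((\<lambda>u. h u * exp (h u)) has_field_derivative deriv h 0) (at 0)"
    using h W0 by (auto intro!: derivative_eq_intros dh)
  then have "deriv h 0 = deriv (\<lambda>u. h u * exp (h u)) 0"
    by (simp add: DERIV_imp_deriv)
  also have "\<dots> = deriv (\<lambda>u. u) 0"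
    by (rule deriv_cong_ev) (use h in auto)
  finally have "deriv h 0 = 1"
    by simp
  then show ?thesis
    by (simp add: lambert_W_deriv_def h_def)
qed

text \<open>
  The hypotheses on \<open>w\<close> let \<open>W\<^sub>k\<close> act on \<open>H\<close> like multiplication by \<open>exp (- w)\<close>: this holds at the
  eigenvalue \<open>w * exp w\<close> by assumption and at the eigenvalue \<open>0\<close> by the hybrid branch convention, and
  if \<open>w = 0\<close>, the nilpotent Jordan blocks of size two are mapped to themselves since
  \<open>W\<^sub>0'(0) = 1\<close>.  The value is thus the same for every Jordan decomposition, which makes the
  definite description meaningful.  The branch point \<open>- exp (-1)\<close> is harmless because all
  larger blocks belong to the eigenvalue \<open>0\<close>.
\<close>

lemma mat_lambert_W_quadratic:
  assumes H: "H \<in> carrier_mat n n"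
    and quad: "H * H = (w * exp w) \<cdot>\<^sub>m H"
    and W: "w \<noteq> 0 \<Longrightarrow> lambert_W k (w * exp w) = w"
  shows "mat_lambert_W_defined k H" and "mat_lambert_W k H = exp (- w) \<cdot>\<^sub>m H"
proof -
  let ?\<mu> = "w * exp w"
  let ?J = "\<lambda>(m, a). jordan_block m a" and ?F = "\<lambda>(m, a). lambert_W_jordan_block k m a"
  \<comment> \<open>A Jordan form of \<open>H\<close> inherits the quadratic relation, and so does each of its blocks.\<close>
  have blk: "m = 1 \<and> (a = 0 \<or> a = ?\<mu>) \<or> m = 2 \<and> a = 0 \<and> ?\<mu> = 0"
    if "0 \<notin> fst ` set blocks" "similar_mat_wit H (jordan_matrix blocks) Z Zinv" "(m, a) \<in> set blocks"
    for blocks Z Zinv m a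
  proof (rule quadratic_jordan_block)
    note sim = similar_mat_witD2[OF H that(2)]
    note [simp] = assoc_mult_mat[of _ n n _ n _ n]
    let ?N = "jordan_matrix blocks"
    have N: "?N = Zinv * H * Z"
      using similar_mat_witD2(3)[OF sim(5) similar_mat_wit_sym[OF that(2)]] .
    have "?N * ?N = Zinv * H * (Z * Zinv) * H * Z"
      using sim(4,6,7) by (simp add: N)
    also have "\<dots> = Zinv * (H * H) * Z"
      using sim(1,4,6,7) by simp
    also have "\<dots> = ?\<mu> \<cdot>\<^sub>m ?N"
      using sim(4,6,7)
      by (simp add: N quad mult_smult_distrib[of _ n n _ n] mult_smult_assoc_mat[of _ n n _ n])
    finally have "?N ^\<^sub>m 2 = ?\<mu> \<cdot>\<^sub>m ?N"
      using sim(5) by (simp add: numeral_2_eq_2)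
    then have eq: "diag_block_mat (map (\<lambda>(m, a). jordan_block m a ^\<^sub>m 2) blocks) =
        diag_block_mat (map (\<lambda>(m, a). ?\<mu> \<cdot>\<^sub>m jordan_block m a) blocks)"
      by (simp add: jordan_matrix_pow)
        (simp add: jordan_matrix_def smult_diag_block_mat o_def case_prod_unfold)
    show "jordan_block m a ^\<^sub>m 2 = ?\<mu> \<cdot>\<^sub>m jordan_block m a"
      using diag_block_mat_map_inj[OF eq _ that(3)] by auto
    show "m \<noteq> 0"
      using that by force
  qed
  have val: "lambert_W_jordan_block k m a = exp (- w) \<cdot>\<^sub>m jordan_block m a"
    if "m = 1 \<and> (a = 0 \<or> a = ?\<mu>) \<or> m = 2 \<and> a = 0 \<and> ?\<mu> = 0" for m a
  proof -
    have W0: "lambert_W_deriv 0 0 0 = 0"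
      using lambert_W_0_real[of 0] by (simp add: lambert_W_deriv_def)
    have Wk: "lambert_W_deriv k 0 ?\<mu> = exp (- w) * ?\<mu>" if "w \<noteq> 0"
      using W[OF that] by (simp add: lambert_W_deriv_def exp_minus)
    show ?thesis
      using that W0 Wk lambert_W_deriv_0_1
      by (intro eq_matI) (auto simp: lambert_W_jordan_block_def less_2_cases_iff)
  qed
  have uniq: "X = exp (- w) \<cdot>\<^sub>m H" if X: "is_mat_lambert_W k H X" for X
  proof -
    obtain blocks Z Zinv where b: "0 \<notin> fst ` set blocks"
      "similar_mat_wit H (jordan_matrix blocks) Z Zinv"
      "X = Z * diag_block_mat (map ?F blocks) * Zinv"
      using X unfolding is_mat_lambert_W_def by blast
    note sim = similar_mat_witD2[OF H b(2)]
    have "map ?F blocks = map ((\<cdot>\<^sub>m) (exp (- w)) \<circ> ?J) blocks"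
      using val blk[OF b(1,2)] by auto
    then have "X = Z * (exp (- w) \<cdot>\<^sub>m jordan_matrix blocks) * Zinv"
      by (simp only: b(3) jordan_matrix_def smult_diag_block_mat map_map)
    also have "\<dots> = exp (- w) \<cdot>\<^sub>m (Z * jordan_matrix blocks * Zinv)"
      using sim(5-7) by (simp add: mult_smult_distrib[of _ n n _ n] mult_smult_assoc_mat[of _ n n _ n])
    finally show ?thesis
      using sim(3) by simp
  qed
  obtain blocks where "jordan_nf H blocks"
    using char_poly_factorized[OF H] jordan_nf_exists[OF H] by blast
  then obtain Z Zinv where b: "0 \<notin> fst ` set blocks" "similar_mat_wit H (jordan_matrix blocks) Z Zinv"
    unfolding jordan_nf_def similar_mat_def by blast
  have "\<forall>(m, a) \<in> set blocks. a = - exp (-1) \<longrightarrow> m = 1"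
    using blk[OF b] by fastforce
  with b have ex: "is_mat_lambert_W k H (Z * diag_block_mat (map ?F blocks) * Zinv)"
    unfolding is_mat_lambert_W_def by blast
  then show "mat_lambert_W_defined k H"
    unfolding mat_lambert_W_defined_def by blast
  show "mat_lambert_W k H = exp (- w) \<cdot>\<^sub>m H"
    unfolding mat_lambert_W_def using ex uniq by (metis the_equality)
qed

section \<open>The exponential of a matrix annihilated by a quadratic with distinct roots\<close>

text \<open>On a matrix annihilated by \<open>(X - x) * (X - y)\<close>, a power series acts like the linear
  polynomial that interpolates it at \<open>x\<close> and \<open>y\<close>.  The powers are of this form by induction, and
  summation over them gives the exponential.\<close>

lemma mat_exp_two_point:
  assumes T: "T \<in> carrier_mat n n"
    and "x \<noteq> y"
    and ann: "(T - x \<cdot>\<^sub>m 1\<^sub>m n) * (T - y \<cdot>\<^sub>m 1\<^sub>m n) = 0\<^sub>m n n"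
  shows "mat_exp T = (exp x / (x - y)) \<cdot>\<^sub>m (T - y \<cdot>\<^sub>m 1\<^sub>m n) - (exp y / (x - y)) \<cdot>\<^sub>m (T - x \<cdot>\<^sub>m 1\<^sub>m n)"
proof -
  let ?X = "T - x \<cdot>\<^sub>m 1\<^sub>m n" and ?Y = "T - y \<cdot>\<^sub>m 1\<^sub>m n"
  have [simp]: "dim_row T = n" "dim_col T = n"
    using T by auto
  have X: "?X \<in> carrier_mat n n" and Y: "?Y \<in> carrier_mat n n"
    using T by auto
  have shift: "T * (T - z \<cdot>\<^sub>m 1\<^sub>m n) = T * T - z \<cdot>\<^sub>m T"
    "(T - z \<cdot>\<^sub>m 1\<^sub>m n) * T = T * T - z \<cdot>\<^sub>m T" for z
    using T by (simp_all add: mult_minus_distrib_mat[of _ n n] minus_mult_distrib_mat[of _ n n]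
        mult_smult_distrib[of _ n n _ n] mult_smult_assoc_mat[of _ n n _ n])
  have "?X * ?Y = T * ?Y - x \<cdot>\<^sub>m ?Y"
    using minus_mult_distrib_mat[OF T _ Y, of "x \<cdot>\<^sub>m 1\<^sub>m n"] mult_smult_assoc_mat[OF one_carrier_mat Y, of x]
      left_mult_one_mat[OF Y] by simp
  then have e: "T * T - y \<cdot>\<^sub>m T - x \<cdot>\<^sub>m ?Y = 0\<^sub>m n n"
    using ann shift(1) by simp
  \<comment> \<open>In this form the annihilation is symmetric in \<open>x\<close> and \<open>y\<close>, so that it yields both of the
    eigenvector relations \<open>YT\<close> and \<open>XT\<close>.\<close>
  have TT: "(T * T) $$ (i, j) = (x + y) * T $$ (i, j) - x * y * 1\<^sub>m n $$ (i, j)" if "i < n" "j < n" for i j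
    using arg_cong[OF e, of "\<lambda>D. D $$ (i, j)"] that
    by (simp add: algebra_simps del: index_mult_mat(1) index_one_mat(1))
  have YT: "?Y * T = x \<cdot>\<^sub>m ?Y" and XT: "?X * T = y \<cdot>\<^sub>m ?X"
    unfolding shift
    by (rule eq_matI; simp add: TT algebra_simps del: index_mult_mat(1) index_one_mat(1))+
  have pow: "T ^\<^sub>m m = (x ^ m / (x - y)) \<cdot>\<^sub>m ?Y - (y ^ m / (x - y)) \<cdot>\<^sub>m ?X" for m
  proof (induction m)
    case 0
    show ?case
      using \<open>x \<noteq> y\<close> by (intro eq_matI) (auto simp flip: diff_divide_distrib)
  next
    case (Suc m)
    have "T ^\<^sub>m Suc m = (x ^ m / (x - y)) \<cdot>\<^sub>m (?Y * T) - (y ^ m / (x - y)) \<cdot>\<^sub>m (?X * T)"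
      unfolding pow_mat.simps Suc.IH
      using minus_mult_distrib_mat[OF smult_carrier_mat[OF Y] smult_carrier_mat[OF X] T]
        mult_smult_assoc_mat[OF X T] mult_smult_assoc_mat[OF Y T] by simp
    also have "\<dots> = (x ^ Suc m / (x - y)) \<cdot>\<^sub>m ?Y - (y ^ Suc m / (x - y)) \<cdot>\<^sub>m ?X"
      unfolding XT YT by (rule eq_matI) (auto simp: mult_ac)
    finally show ?case .
  qed
  show ?thesis
  proof (rule eq_matI)
    fix i j
    assume "i < dim_row ((exp x / (x - y)) \<cdot>\<^sub>m ?Y - (exp y / (x - y)) \<cdot>\<^sub>m ?X)"
      "j < dim_col ((exp x / (x - y)) \<cdot>\<^sub>m ?Y - (exp y / (x - y)) \<cdot>\<^sub>m ?X)"
    then have ij: "i < n" "j < n"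
      by auto
    have ex: "(\<lambda>m. z ^ m / fact m) sums exp z" for z :: complex
      using exp_converges[of z] by (simp add: scaleR_conv_of_real field_simps)
    have "(\<lambda>m. x ^ m / fact m * (?Y $$ (i, j) / (x - y)) - y ^ m / fact m * (?X $$ (i, j) / (x - y)))
      sums (exp x * (?Y $$ (i, j) / (x - y)) - exp y * (?X $$ (i, j) / (x - y)))"
      by (intro sums_diff sums_mult2 ex)
    moreover have "(T ^\<^sub>m m) $$ (i, j) / fact m =
        x ^ m / fact m * (?Y $$ (i, j) / (x - y)) - y ^ m / fact m * (?X $$ (i, j) / (x - y))" for m
    proof -
      have "(p / d * u - q / d * v) / c = p / c * (u / d) - q / c * (v / d)" for p q u v c d :: complex
        by (simp add: diff_divide_distrib mult_ac)
      moreover have "(T ^\<^sub>m m) $$ (i, j) =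
          x ^ m / (x - y) * ?Y $$ (i, j) - y ^ m / (x - y) * ?X $$ (i, j)"
        unfolding pow using ij by simp
      ultimately show ?thesis
        by (simp only:)
    qed
    ultimately have "(\<lambda>m. (T ^\<^sub>m m) $$ (i, j) / fact m)
        sums (exp x * (?Y $$ (i, j) / (x - y)) - exp y * (?X $$ (i, j) / (x - y)))"
      by simp
    then show "mat_exp T $$ (i, j) =
        ((exp x / (x - y)) \<cdot>\<^sub>m ?Y - (exp y / (x - y)) \<cdot>\<^sub>m ?X) $$ (i, j)"
      using ij by (simp add: mat_exp_def sums_iff)
  qed (auto simp: mat_exp_def)
qed

section \<open>Two-by-two matrices\<close>

definition mat2 :: "'a \<Rightarrow> 'a \<Rightarrow> 'a \<Rightarrow> 'a \<Rightarrow> 'a mat" where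
  "mat2 a b c d = mat_of_rows_list 2 [[a, b], [c, d]]"

lemma mat2_index [simp]:
  "dim_row (mat2 a b c d) = 2" "dim_col (mat2 a b c d) = 2"
  "mat2 a b c d $$ (0, 0) = a" "mat2 a b c d $$ (0, Suc 0) = b"
  "mat2 a b c d $$ (Suc 0, 0) = c" "mat2 a b c d $$ (Suc 0, Suc 0) = d"
  by (simp_all add: mat2_def mat_of_rows_list_def)

lemma mat2_carrier [simp]: "mat2 a b c d \<in> carrier_mat 2 2"
  by (rule carrier_matI) simp_all

lemma sum_2: "(\<Sum>i = 0..<2. f i) = f 0 + (f (Suc 0) :: 'a :: comm_monoid_add)"
  by (simp add: numeral_2_eq_2)

lemma mat2_arith:
  fixes a b c d :: "'a :: comm_ring_1"
  shows "mat2 a b c d + mat2 a' b' c' d' = mat2 (a + a') (b + b') (c + c') (d + d')"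
    and "mat2 a b c d - mat2 a' b' c' d' = mat2 (a - a') (b - b') (c - c') (d - d')"
    and "x \<cdot>\<^sub>m mat2 a b c d = mat2 (x * a) (x * b) (x * c) (x * d)"
    and "mat2 a b c d * mat2 a' b' c' d' =
      mat2 (a * a' + b * c') (a * b' + b * d') (c * a' + d * c') (c * b' + d * d')"
    and "1\<^sub>m 2 = mat2 1 0 0 (1 :: 'a)"
    and "0\<^sub>m 2 2 = mat2 0 0 0 (0 :: 'a)"
  by (auto intro!: eq_matI simp: less_2_cases_iff scalar_prod_def sum_2)

lemma mat2_eq_iff:
  "mat2 a b c d = mat2 a' b' c' d' \<longleftrightarrow> a = a' \<and> b = b' \<and> c = c' \<and> d = d'"
  by (metis mat2_index(3-6))

lemma cmat_mat2: "cmat (mat2 a b c d) = mat2 (of_real a) (of_real b) (of_real c) (of_real d)"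
  by (auto intro!: eq_matI simp: less_2_cases_iff)

lemma det_mat2: "Determinant.det (mat2 a b c d) = a * d - b * (c :: 'a :: comm_ring_1)"
proof -
  have "Determinant.det (mat_delete (mat2 a b c d) i 0) = mat2 a b c d $$ (1 - i, 1)" if "i < 2" for i
    using that by (subst det_single) (auto simp: mat_delete_def less_2_cases_iff)
  then show ?thesis
    by (subst laplace_expansion_column[of _ 2 0])
      (auto simp: cofactor_def numeral_2_eq_2 algebra_simps)
qed

lemma spectrum_companion:
  "spectrum (mat2 0 1 (- x * y) (x + y)) = {x, y :: complex}"
proof -
  have "eigenvalue (mat2 0 1 (- x * y) (x + y)) z \<longleftrightarrow> (z - x) * (z - y) = 0" for z
    unfolding eigenvalue_det[OF mat2_carrier] char_matrix_def mat2_index mat2_arith det_mat2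
    by (simp add: algebra_simps)
  then show ?thesis
    by (auto simp: spectrum_def)
qed

section \<open>Prescribing two characteristic roots\<close>

lemma characteristic_root_real_iff:
  "characteristic_root (mat2 0 1 a21 a22) (mat2 0 0 b21 b22) \<tau> (of_real l) \<longleftrightarrow>
     exp (l * \<tau>) * (l\<^sup>2 - a21 - a22 * l) = b21 + b22 * l"
proof -
  have "delay_char_fun (mat2 0 1 a21 a22) (mat2 0 0 b21 b22) \<tau> (of_real l)
      = of_real (l\<^sup>2 - a21 - a22 * l - exp (- l * \<tau>) * (b21 + b22 * l))"
    unfolding delay_char_fun_def cmat_mat2 mat2_index mat2_arith det_mat2
    by (simp add: algebra_simps power2_eq_square flip: exp_of_real)
  then have "characteristic_root (mat2 0 1 a21 a22) (mat2 0 0 b21 b22) \<tau> (of_real l) \<longleftrightarrow>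
      l\<^sup>2 - a21 - a22 * l - exp (- l * \<tau>) * (b21 + b22 * l) = 0"
    unfolding characteristic_root_def by (simp only: of_real_eq_0_iff)
  then show ?thesis
    by (simp add: exp_minus field_simps)
qed

text \<open>The matrix in the exponential is \<open>\<tau>\<close> times the companion matrix with eigenvalues \<open>x\<close> and \<open>y\<close>.
  The hypotheses compare the two sides on its eigenvectors \<open>(1, x)\<close> and \<open>(1, y)\<close>, which form a
  basis.\<close>

lemma mult_mat_exp_companion:
  fixes w1 w2 \<tau> x y :: complex
  assumes "x \<noteq> y" "\<tau> \<noteq> 0"
    and x: "exp (\<tau> * x) * (w1 + w2 * x) = \<tau> * (b1 + b2 * x)"
    and y: "exp (\<tau> * y) * (w1 + w2 * y) = \<tau> * (b1 + b2 * y)"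
  shows "mat2 0 0 w1 w2 * mat_exp (mat2 0 \<tau> (- \<tau> * x * y) (\<tau> * (x + y))) = \<tau> \<cdot>\<^sub>m mat2 0 0 b1 b2"
proof -
  let ?T = "mat2 0 \<tau> (- \<tau> * x * y) (\<tau> * (x + y))"
  define p where "p = exp (\<tau> * x)"
  define q where "q = exp (\<tau> * y)"
  have "mat_exp ?T = (p / (\<tau> * x - \<tau> * y)) \<cdot>\<^sub>m (?T - (\<tau> * y) \<cdot>\<^sub>m 1\<^sub>m 2)
      - (q / (\<tau> * x - \<tau> * y)) \<cdot>\<^sub>m (?T - (\<tau> * x) \<cdot>\<^sub>m 1\<^sub>m 2)"
    unfolding p_def q_def
    by (rule mat_exp_two_point) (use assms in \<open>auto simp: mat2_arith algebra_simps\<close>)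
  also have "\<dots> = (1 / (x - y)) \<cdot>\<^sub>m
      mat2 (q * x - p * y) (p - q) (x * y * (q - p)) (p * x - q * y)"
  proof -
    have [simp]: "\<tau> \<noteq> 0" "\<tau> * x - \<tau> * y \<noteq> 0" "x - y \<noteq> 0" "\<tau> * x \<noteq> \<tau> * y"
      using assms by auto
    show ?thesis
      unfolding mat2_arith mat2_eq_iff
      by (intro conjI; simp add: divide_simps; simp add: algebra_simps)
  qed
  finally have E: "mat_exp ?T = (1 / (x - y)) \<cdot>\<^sub>m
      mat2 (q * x - p * y) (p - q) (x * y * (q - p)) (p * x - q * y)" .
  have "w1 * (q * x - p * y) + w2 * (x * y * (q - p)) =
      x * (q * (w1 + w2 * y)) - y * (p * (w1 + w2 * x))"
    by (simp add: algebra_simps)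
  also have "\<dots> = \<tau> * b1 * (x - y)"
    unfolding p_def q_def x y by (simp add: algebra_simps)
  finally have 1: "w1 * (q * x - p * y) + w2 * (x * y * (q - p)) = \<tau> * b1 * (x - y)" .
  have "w1 * (p - q) + w2 * (p * x - q * y) = p * (w1 + w2 * x) - q * (w1 + w2 * y)"
    by (simp add: algebra_simps)
  also have "\<dots> = \<tau> * b2 * (x - y)"
    unfolding p_def q_def x y by (simp add: algebra_simps)
  finally have 2: "w1 * (p - q) + w2 * (p * x - q * y) = \<tau> * b2 * (x - y)" .
  have "mat2 0 0 w1 w2 * mat_exp ?T = (1 / (x - y)) \<cdot>\<^sub>m
     mat2 0 0 (w1 * (q * x - p * y) + w2 * (x * y * (q - p))) (w1 * (p - q) + w2 * (p * x - q * y))"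
    unfolding E mat2_arith mat2_eq_iff
    by (simp add: algebra_simps add_divide_distrib diff_divide_distrib)
  also have "\<dots> = \<tau> \<cdot>\<^sub>m mat2 0 0 b1 b2"
    unfolding 1 2 using assms by (simp add: mat2_arith)
  finally show ?thesis .
qed

theorem proposition2:
  fixes \<tau> a21 a22 b21 b22 l1 l2 :: real and A B :: "real mat"
  assumes "\<tau> > 0"
    and A: "A = mat_of_rows_list 2 [[0, 1], [a21, a22]]"
    and B: "B = mat_of_rows_list 2 [[0, 0], [b21, b22]]"
    and "l1 \<noteq> l2"
    and "simple_characteristic_root A B \<tau> (complex_of_real l1)"
    and "simple_characteristic_root A B \<tau> (complex_of_real l2)"
  shows "\<exists>k \<in> {0, -1 :: int}. \<exists>M \<in> carrier_mat 2 2. \<exists>Q \<in> carrier_mat 2 2.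
           M = \<tau> \<cdot>\<^sub>m (B * Q) \<and>
           mat_lambert_W_defined k (cmat M) \<and>
           mat_lambert_W k (cmat M)
             * mat_exp (mat_lambert_W k (cmat M) + complex_of_real \<tau> \<cdot>\<^sub>m cmat A)
             - complex_of_real \<tau> \<cdot>\<^sub>m cmat B = 0\<^sub>m 2 2 \<and>
           spectrum (complex_of_real (1 / \<tau>) \<cdot>\<^sub>m mat_lambert_W k (cmat M) + cmat A)
             = {complex_of_real l1, complex_of_real l2}"
proof -
  have A2: "A = mat2 0 1 a21 a22" and B2: "B = mat2 0 0 b21 b22"
    by (simp_all add: A B mat2_def)
  \<comment> \<open>The entries that turn \<open>A + W / \<tau>\<close> into the companion matrix of \<open>(s - l1) * (s - l2)\<close>.\<close>
  define w1 where "w1 = \<tau> * (- l1 * l2 - a21)"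
  define w2 where "w2 = \<tau> * (l1 + l2 - a22)"
  \<comment> \<open>At a root of \<open>(s - l1) * (s - l2)\<close> the expression \<open>w1 + w2 * s\<close> reduces to
    \<open>\<tau> * (s\<^sup>2 - a21 - a22 * s)\<close>, which is what the characteristic equation determines.\<close>
  have roots: "exp (\<tau> * l) * (w1 + w2 * l) = \<tau> * (b21 + b22 * l)" if "l \<in> {l1, l2}" for l
  proof -
    have "characteristic_root A B \<tau> (of_real l)"
      using that assms(5,6) by (auto simp: simple_characteristic_root_def)
    then have c: "exp (\<tau> * l) * (l\<^sup>2 - a21 - a22 * l) = b21 + b22 * l"
      by (simp add: A2 B2 characteristic_root_real_iff mult.commute)
    have "w1 + w2 * l = \<tau> * (l\<^sup>2 - a21 - a22 * l)"
      using that by (auto simp: w1_def w2_def algebra_simps power2_eq_square)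
    with c show ?thesis
      by (simp add: mult.left_commute)
  qed
  define k :: int where "k = (if w2 \<ge> -1 then 0 else -1)"
  define M where "M = exp w2 \<cdot>\<^sub>m mat2 0 0 w1 w2"
  \<comment> \<open>\<open>Q\<close> multiplies the second row of \<open>M\<close> by a right inverse of \<open>\<tau> * (b21, b22)\<close>.  If that row
    vanishes, \<open>c = 0\<close> because division by zero yields zero, so that \<open>Q = 0\<close>.\<close>
  define c where "c = exp w2 / (\<tau> * (b21\<^sup>2 + b22\<^sup>2))"
  define Q where "Q = c \<cdot>\<^sub>m mat2 (b21 * w1) (b21 * w2) (b22 * w1) (b22 * w2)"
  \<comment> \<open>Without delay term the characteristic polynomial of \<open>A\<close> has the roots \<open>l1\<close> and \<open>l2\<close> already,
    so no correction of \<open>A\<close> is called for.\<close>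
  have B0: "w1 = 0 \<and> w2 = 0" if "b21\<^sup>2 + b22\<^sup>2 = 0"
  proof -
    have "w1 + w2 * l1 = 0" "w1 + w2 * l2 = 0"
      using roots[of l1] roots[of l2] that by auto
    moreover have "w2 * (l1 - l2) = (w1 + w2 * l1) - (w1 + w2 * l2)"
      by (simp add: algebra_simps)
    ultimately have "w2 * (l1 - l2) = 0"
      by simp
    then show ?thesis
      using \<open>w1 + w2 * l1 = 0\<close> \<open>l1 \<noteq> l2\<close> by auto
  qed
  have MQ: "M = \<tau> \<cdot>\<^sub>m (B * Q)"
  proof (cases "b21\<^sup>2 + b22\<^sup>2 = 0")
    case True
    then show ?thesis
      using B0 by (simp add: M_def Q_def B2 mat2_arith)
  next
    case False
    have c: "c * (\<tau> * (b21\<^sup>2 + b22\<^sup>2)) = exp w2"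
      using False \<open>\<tau> > 0\<close> by (simp add: c_def)
    show ?thesis
      unfolding M_def Q_def B2 c[symmetric] mat2_arith mat2_eq_iff
      by (simp add: algebra_simps power2_eq_square)
  qed
  define W where "W = mat2 0 0 (complex_of_real w1) (of_real w2)"
  have cM: "cmat M = exp (complex_of_real w2) \<cdot>\<^sub>m W"
    by (simp add: M_def W_def mat2_arith cmat_mat2 exp_of_real)
  have quad: "cmat M * cmat M = (complex_of_real w2 * exp (of_real w2)) \<cdot>\<^sub>m cmat M"
    by (simp add: cM W_def mat2_arith mult_ac)
  have branch: "lambert_W k (complex_of_real w2 * exp (of_real w2)) = of_real w2"
    using lambert_W_0_real[of w2] lambert_W_minus_1_real[of w2] by (auto simp: k_def exp_of_real)
  have "cmat M \<in> carrier_mat 2 2"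
    by (simp add: cM W_def mat2_arith)
  note LW = mat_lambert_W_quadratic[OF this quad branch]
  have mW: "mat_lambert_W k (cmat M) = W"
    unfolding LW(2) unfolding cM by (simp add: W_def mat2_arith exp_minus flip: mult.assoc)
  have T: "W + complex_of_real \<tau> \<cdot>\<^sub>m cmat A =
      mat2 0 (of_real \<tau>) (- of_real \<tau> * of_real l1 * of_real l2) (of_real \<tau> * (of_real l1 + of_real l2))"
    by (simp add: A2 W_def mat2_arith cmat_mat2 w1_def w2_def algebra_simps)
  have croots: "exp (complex_of_real \<tau> * of_real l) * (of_real w1 + of_real w2 * of_real l)
      = of_real \<tau> * (of_real b21 + of_real b22 * of_real l)" if "l \<in> {l1, l2}" for l
    using arg_cong[OF roots[OF that], of complex_of_real] by (simp flip: exp_of_real)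
  have WE: "W * mat_exp (W + complex_of_real \<tau> \<cdot>\<^sub>m cmat A) = complex_of_real \<tau> \<cdot>\<^sub>m cmat B"
    unfolding T using mult_mat_exp_companion[OF _ _ croots croots, of l1 l2] \<open>l1 \<noteq> l2\<close> \<open>\<tau> > 0\<close>
    by (simp add: W_def B2 cmat_mat2)
  have S: "complex_of_real (1 / \<tau>) \<cdot>\<^sub>m W + cmat A =
      mat2 0 1 (- of_real l1 * of_real l2) (of_real l1 + of_real l2)"
    using \<open>\<tau> > 0\<close> by (simp add: A2 W_def mat2_arith cmat_mat2 w1_def w2_def)
  show ?thesis
  proof (intro bexI conjI)
    show "M = \<tau> \<cdot>\<^sub>m (B * Q)" "mat_lambert_W_defined k (cmat M)"
      by (fact MQ, fact LW(1))
    show "mat_lambert_W k (cmat M) * mat_exp (mat_lambert_W k (cmat M) + complex_of_real \<tau> \<cdot>\<^sub>m cmat A)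
        - complex_of_real \<tau> \<cdot>\<^sub>m cmat B = 0\<^sub>m 2 2"
      unfolding mW WE by (simp add: B2 cmat_mat2 mat2_arith)
    show "spectrum (complex_of_real (1 / \<tau>) \<cdot>\<^sub>m mat_lambert_W k (cmat M) + cmat A)
        = {complex_of_real l1, complex_of_real l2}"
      unfolding mW S by (rule spectrum_companion)
  qed (auto simp: k_def M_def Q_def)
qed

end
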